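(* Let $L/K$ be a finite extension with maximal separable subextension $L_S/K$. The number of distinct extensions $L'/K$ (inside $\bar K$) that are isomorphic to $L/K$ and satisfy $L'_S=L_S$ is exactly $s_K(L)/s_K(L_S)$.
   Context: $K$ is any field (not necessarily perfect) with a fixed algebraic closure $\bar K$; all extensions are finite and contained in $\bar K$. For an extension $E/K$, $E_S$ denotes its maximal separable subextension, and $s_K(E)$ is the number of distinct subfields of $\bar K$ isomorphic to $E$ over $K$. *)

theory Defs
  imports Complex_Main "HOL-Algebra.Algebra"
begin

text \<open>
  Throughout, \<open>R\<close> is meant to be an algebraic closure of its subfield \<open>K\<close>
  (locale \<^locale>\<open>algebraic_closure\<close>), and extensions of \<open>K\<close> are intermediate fields,
  given by their carrier sets.
\<close>

definition intermediate_field :: "('a, 'b) ring_scheme \<Rightarrow> 'a set \<Rightarrow> 'a set \<Rightarrow> 'a set \<Rightarrow> bool"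
  where "intermediate_field R K E F \<longleftrightarrow> subfield F R \<and> K \<subseteq> F \<and> F \<subseteq> E"

definition finite_ext :: "('a, 'b) ring_scheme \<Rightarrow> 'a set \<Rightarrow> 'a set \<Rightarrow> bool"
  where "finite_ext R K E \<longleftrightarrow>
    intermediate_field R K (carrier R) E \<and> ring.finite_dimension R K E"

text \<open>
  The minimal polynomial of \<open>x\<close> has no multiple root. Multiplicities are taken in \<open>R\<close>,
  so this is separability only because \<open>R\<close> is algebraically closed.
\<close>

definition separable_elem :: "('a, 'b) ring_scheme \<Rightarrow> 'a set \<Rightarrow> 'a \<Rightarrow> bool"
  where "separable_elem R K x \<longleftrightarrow>
    ring.algebraic R K x \<and> (\<forall>a \<in> carrier R. ring.alg_mult R (ring.Irr R K x) a \<le> 1)"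

definition separable_ext :: "('a, 'b) ring_scheme \<Rightarrow> 'a set \<Rightarrow> 'a set \<Rightarrow> bool"
  where "separable_ext R K E \<longleftrightarrow> (\<forall>x \<in> E. separable_elem R K x)"

text \<open>The subextension \<open>E\<^sub>S\<close>; the order is inclusion.\<close>

definition max_separable_subext :: "('a, 'b) ring_scheme \<Rightarrow> 'a set \<Rightarrow> 'a set \<Rightarrow> 'a set"
  where "max_separable_subext R K E =
    (GREATEST F. intermediate_field R K E F \<and> separable_ext R K F)"

definition isomorphic_over :: "('a, 'b) ring_scheme \<Rightarrow> 'a set \<Rightarrow> 'a set \<Rightarrow> 'a set \<Rightarrow> bool"
  where "isomorphic_over R K E F \<longleftrightarrow>
    (\<exists>h \<in> ring_iso (R \<lparr> carrier := E \<rparr>) (R \<lparr> carrier := F \<rparr>). \<forall>k \<in> K. h k = k)"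

definition conjugate_fields :: "('a, 'b) ring_scheme \<Rightarrow> 'a set \<Rightarrow> 'a set \<Rightarrow> 'a set set"
  where "conjugate_fields R K E =
    {F. intermediate_field R K (carrier R) F \<and> isomorphic_over R K E F}"

text \<open>The number \<open>s\<^sub>K(E)\<close>.\<close>

definition num_conjugate_fields :: "('a, 'b) ring_scheme \<Rightarrow> 'a set \<Rightarrow> 'a set \<Rightarrow> nat"
  where "num_conjugate_fields R K E = card (conjugate_fields R K E)"

end

theory Submission
  imports Defs
begin

text \<open>
  Every \<open>K\<close>-isomorphism between subextensions of the algebraic closure extends to an automorphism
  (by Zorn's lemma), so the extensions isomorphic to \<open>L\<close> form the orbit of \<open>L\<close> under
  \<open>Gal K\<close>, and this orbit is finite because an automorphism moves each element of a basis of \<open>L\<close>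
  to one of finitely many conjugates. The map sending \<open>L'\<close> to its maximal separable subextension is
  equivariant, hence a surjection from the orbit of \<open>L\<close> onto the orbit of \<open>L\<^sub>S\<close> whose fibres all
  have the same cardinality.

  That \<open>L\<^sub>S\<close> exists, i.e. that the separable elements form a field, is shown without derivatives:
  the number of embeddings of \<open>E\<close> over \<open>F\<close> is multiplicative in towers and bounded by the degree, and
  for \<open>E = F(x)\<close> it equals the degree iff \<open>x\<close> is separable. If \<open>a\<close> and \<open>b\<close> are separable, equality
  holds for \<open>K(a,b)\<close>, and therefore at the bottom step of every tower \<open>K(c) \<subseteq> K(a,b)\<close>.
\<close>

section \<open>Extension of homomorphisms\<close>

text \<open>The value at \<open>f a\<close> is forced to be \<open>g a\<close>, and the kernel
  condition makes it independent of the preimage chosen. Working with chosen preimages in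
  \<open>A\<close> yields a map on \<open>B\<close> directly, with no quotient ring in
  between.\<close>

lemma ring_hom_factor:
  assumes "ring A" "ring C"
    and f: "f \<in> ring_hom A B" and surj: "f ` carrier A = carrier B" and B: "ring B"
    and g: "g \<in> ring_hom A C"
    and ker: "\<And>a. a \<in> carrier A \<Longrightarrow> f a = \<zero>\<^bsub>B\<^esub> \<Longrightarrow> g a = \<zero>\<^bsub>C\<^esub>"
  shows "\<exists>h \<in> ring_hom B C. \<forall>a \<in> carrier A. h (f a) = g a"
proof -
  interpret F: ring_hom_ring A B f using ring_hom_ringI2[OF assms(1) B f] .
  interpret G: ring_hom_ring A C g using ring_hom_ringI2[OF assms(1,2) g] .
  have eq: "g a = g b" if "a \<in> carrier A" "b \<in> carrier A" "f a = f b" for a b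
  proof -
    have "f (a \<ominus>\<^bsub>A\<^esub> b) = \<zero>\<^bsub>B\<^esub>"
      using that by (simp add: a_minus_def F.S.r_neg)
    hence "g (a \<ominus>\<^bsub>A\<^esub> b) = \<zero>\<^bsub>C\<^esub>"
      using ker that by simp
    hence "g a \<ominus>\<^bsub>C\<^esub> g b = \<zero>\<^bsub>C\<^esub>"
      using that by (simp add: a_minus_def)
    thus ?thesis
      using that by simp
  qed
  define h where "h b = g (SOME a. a \<in> carrier A \<and> f a = b)" for b
  have h: "h (f a) = g a" if "a \<in> carrier A" for a
  proof -
    let ?P = "\<lambda>a'. a' \<in> carrier A \<and> f a' = f a"
    have "?P (SOME a'. ?P a')"
      using someI[of ?P a] that by simp
    then show ?thesis
      unfolding h_def by (intro eq) (use that in auto)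
  qed
  have "h \<in> ring_hom B C"
  proof (rule ring_hom_memI)
    fix x y assume "x \<in> carrier B" "y \<in> carrier B"
    then obtain a b where ab: "a \<in> carrier A" "b \<in> carrier A" "x = f a" "y = f b"
      using surj by blast
    show "h x \<in> carrier C"
      using ab h by simp
    have "h (f (a \<otimes>\<^bsub>A\<^esub> b)) = h (f a) \<otimes>\<^bsub>C\<^esub> h (f b)" "h (f (a \<oplus>\<^bsub>A\<^esub> b)) = h (f a) \<oplus>\<^bsub>C\<^esub> h (f b)"
      using ab h by (simp_all del: F.hom_mult F.hom_add)
    thus "h (x \<otimes>\<^bsub>B\<^esub> y) = h x \<otimes>\<^bsub>C\<^esub> h y" "h (x \<oplus>\<^bsub>B\<^esub> y) = h x \<oplus>\<^bsub>C\<^esub> h y"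
      using ab by auto
  next
    show "h \<one>\<^bsub>B\<^esub> = \<one>\<^bsub>C\<^esub>"
      using h[of "\<one>\<^bsub>A\<^esub>"] by simp
  qed
  thus ?thesis
    using h by blast
qed

text \<open>Polynomials are coefficient lists without leading zeros, and applying \<open>h\<close>
  to the coefficients may create leading zeros. So \<open>map h\<close> respects sums and products
  only up to \<open>normalize\<close>; evaluation does not see the difference.\<close>

lemma (in domain) eval_map_hom:
  assumes F: "subring F R" and h: "h \<in> ring_hom (R \<lparr> carrier := F \<rparr>) R" and y: "y \<in> carrier R"
  shows "(\<lambda>p. eval (map h p) y) \<in> ring_hom (F[X]) R"
proof -
  interpret H: ring_hom_ring "R \<lparr> carrier := F \<rparr>" R h
    using ring_hom_ringI2[OF subring_is_ring[OF F] ring_axioms h] .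
  have sF: "set p \<subseteq> F" if "p \<in> carrier (F[X])" for p
    using that polynomial_incl unfolding univ_poly_carrier[symmetric] by blast
  have FR: "F \<subseteq> carrier R" by (rule subringE(1)[OF F])
  have sh: "set (map h p) \<subseteq> carrier R" if "set p \<subseteq> F" for p
    using that ring_hom_memE(1)[OF h] by auto
  show ?thesis
  proof (rule ring_hom_memI)
    fix p q assume pq: "p \<in> carrier (F[X])" "q \<in> carrier (F[X])"
    note p = sF[OF pq(1)] and q = sF[OF pq(2)]
    show "eval (map h p) y \<in> carrier R"
      using eval_in_carrier[OF sh[OF p] y] .
    have "normalize (map h (poly_add p q)) = poly_add (map h p) (map h q)"
      using H.poly_add_hom'[of p q] p q unfolding poly_add_consistent[OF F] by simp
    moreover have "set (poly_add p q) \<subseteq> F"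
      using sF[of "p \<oplus>\<^bsub>F[X]\<^esub> q"] ring.ring_simprules(1)[OF univ_poly_is_ring[OF F] pq]
      unfolding univ_poly_add by blast
    ultimately have "eval (map h (poly_add p q)) y = eval (poly_add (map h p) (map h q)) y"
      using eval_normalize[OF sh y] by metis
    thus "eval (map h (p \<oplus>\<^bsub>F[X]\<^esub> q)) y = eval (map h p) y \<oplus> eval (map h q) y"
      using eval_poly_add[OF sh[OF p] sh[OF q] y] unfolding univ_poly_add by simp
    have "normalize (map h (poly_mult p q)) = poly_mult (map h p) (map h q)"
      using H.poly_mult_hom'[of p q] p q unfolding poly_mult_consistent[OF F] by simp
    moreover have "set (poly_mult p q) \<subseteq> F"
      using sF[of "p \<otimes>\<^bsub>F[X]\<^esub> q"] ring.ring_simprules(5)[OF univ_poly_is_ring[OF F] pq]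
      unfolding univ_poly_mult by blast
    ultimately have "eval (map h (poly_mult p q)) y = eval (poly_mult (map h p) (map h q)) y"
      using eval_normalize[OF sh y] by metis
    thus "eval (map h (p \<otimes>\<^bsub>F[X]\<^esub> q)) y = eval (map h p) y \<otimes> eval (map h q) y"
      using eval_poly_mult[OF sh[OF p] sh[OF q] y] unfolding univ_poly_mult by simp
  next
    show "eval (map h \<one>\<^bsub>F[X]\<^esub>) y = \<one>"
      using y H.hom_one unfolding univ_poly_one by simp
  qed
qed

text \<open>Evaluation at \<open>x\<close> maps F[X] onto F(x), and every polynomial in its kernel
  is a multiple of \<open>Irr F x\<close>. Applying \<open>h\<close> to the coefficients and
  evaluating at \<open>y\<close> kills \<open>Irr F x\<close>, so this second homomorphism factors
  through the first.\<close>

lemma (in domain) hom_extend_simple_extension: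
  assumes F: "subfield F R" and x: "x \<in> carrier R" and alg: "(algebraic over F) x"
    and h: "h \<in> ring_hom (R \<lparr> carrier := F \<rparr>) R"
    and y: "y \<in> carrier R" and root: "eval (map h (Irr F x)) y = \<zero>"
  shows "\<exists>g \<in> ring_hom (R \<lparr> carrier := simple_extension F x \<rparr>) R. (\<forall>a \<in> F. g a = h a) \<and> g x = y"
proof -
  note FR = subfieldE(1)[OF F]
  note Irr = IrrE[OF F x alg]
  interpret UP: ring "F[X]" using univ_poly_is_ring[OF FR] .
  interpret H: ring_hom_ring "R \<lparr> carrier := F \<rparr>" R h
    using ring_hom_ringI2[OF subring_is_ring[OF FR] ring_axioms h] .
  interpret P: ring_hom_ring "F[X]" R "\<lambda>p. eval (map h p) y"
    using ring_hom_ringI2[OF UP.ring_axioms ring_axioms eval_map_hom[OF FR h y]] .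
  have img: "(\<lambda>p. eval p x) ` carrier (F[X]) = simple_extension F x"
    using simple_extension_as_eval_img[OF subringE(1)[OF FR] x] by simp
  have "(\<lambda>p. eval p x) \<in> ring_hom (F[X]) (R \<lparr> carrier := simple_extension F x \<rparr>)"
    using ring_hom_memE[OF eval_is_hom[OF FR x]] unfolding img[symmetric]
    by (intro ring_hom_memI) simp_all
  moreover have "ring (R \<lparr> carrier := simple_extension F x \<rparr>)"
    using subring_is_ring[OF simple_extension_is_subring[OF FR x]] .
  moreover have "eval (map h p) y = \<zero>" if p: "p \<in> carrier (F[X])" "eval p x = \<zero>" for p
  proof -
    have "Irr F x divides\<^bsub>F[X]\<^esub> p"
      using Irr_minimal[OF F x alg p] pdivides_iff_shell[OF F Irr(1) p(1)] by simp
    then obtain q where q: "q \<in> carrier (F[X])" "p = Irr F x \<otimes>\<^bsub>F[X]\<^esub> q"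
      unfolding factor_def by blast
    thus ?thesis
      using P.hom_mult[OF Irr(1) q(1)] P.hom_closed[OF q(1)] root by simp
  qed
  ultimately have "\<exists>g \<in> ring_hom (R \<lparr> carrier := simple_extension F x \<rparr>) R.
      \<forall>p \<in> carrier (F[X]). g (eval p x) = eval (map h p) y"
    by (intro ring_hom_factor[OF UP.ring_axioms ring_axioms _ _ _ P.homh]) (simp_all add: img)
  then obtain g where g: "g \<in> ring_hom (R \<lparr> carrier := simple_extension F x \<rparr>) R"
    and eq: "\<And>p. p \<in> carrier (F[X]) \<Longrightarrow> g (eval p x) = eval (map h p) y"
    by blast
  \<comment> \<open>The constant polynomial \<open>[a]\<close> is a legal list only for nonzero
    \<open>a\<close>; the zero polynomial is the empty list.\<close>
  have "g a = h a" if a: "a \<in> F" for a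
  proof (cases "a = \<zero>")
    case True
    have "[] \<in> carrier (F[X])"
      by (simp add: univ_poly_zero_closed)
    from eq[OF this] show ?thesis
      using True H.hom_zero by simp
  next
    case False
    then have "[a] \<in> carrier (F[X])"
      using a unfolding univ_poly_carrier[symmetric] polynomial_def by simp
    note eq[OF this]
    moreover have "a \<in> carrier R" "h a \<in> carrier R"
      using a subringE(1)[OF FR] ring_hom_memE(1)[OF h] by auto
    ultimately show ?thesis
      using x y by simp
  qed
  moreover have "g x = y"
  proof -
    have "[\<one>, \<zero>] \<in> carrier (F[X])"
      using subringE(2,3)[OF FR] one_not_zero unfolding univ_poly_carrier[symmetric] polynomial_def by simp
    note eq[OF this]
    moreover have "h \<one> = \<one>" "h \<zero> = \<zero>"
      using H.hom_zero H.hom_one by simp_all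
    ultimately show ?thesis
      using x y by simp
  qed
  ultimately show ?thesis
    using g by blast
qed

section \<open>Extending homomorphisms to the algebraic closure\<close>

text \<open>A homomorphism of fields keeps the leading coefficient nonzero, so the transported
  polynomial still has degree at least 1, and it splits over \<open>L\<close>. The root is the
  target needed to extend \<open>g\<close> from F to F(x).\<close>

lemma (in algebraic_closure) map_Irr_has_root:
  assumes F: "subfield F L" and g: "g \<in> ring_hom (L \<lparr> carrier := F \<rparr>) L"
    and x: "x \<in> carrier L" and alg: "(algebraic over F) x"
  obtains y where "y \<in> carrier L" "eval (map g (Irr F x)) y = \<zero>"
proof -
  note Irr = IrrE[OF F x alg]
  have "Irr F x \<in> carrier (poly_ring (L \<lparr> carrier := F \<rparr>))"
    using Irr(1) univ_poly_consistent[OF subfieldE(1)[OF F]] by simp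
  then have in_carrier: "map g (Irr F x) \<in> carrier (poly_ring L)"
    using polynomial_hom[OF g subfield_iff(2)[OF F] field_axioms] by simp
  have "degree (Irr F x) \<ge> 1"
    using pirreducible_degree[OF F Irr(1,2)] .
  then have "size (roots (map g (Irr F x))) \<ge> 1"
    using roots_over_carrier[OF in_carrier] unfolding splitted_def by simp
  then have "roots (map g (Irr F x)) \<noteq> {#}"
    by auto
  then obtain y where "y \<in># roots (map g (Irr F x))"
    by blast
  then show thesis
    using that roots_mem_iff_is_root[OF in_carrier] unfolding is_root_def by blast
qed

lemma (in algebraic_closure) hom_extend_closure:
  assumes F: "subfield F L" and KF: "K \<subseteq> F" and h: "h \<in> ring_hom (L \<lparr> carrier := F \<rparr>) L"
  shows "\<exists>g \<in> ring_hom L L. \<forall>a \<in> F. g a = h a"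
proof -
  \<comment> \<open>Zorn's lemma is applied to graphs, so that extension of homomorphisms becomes inclusion.\<close>
  define graph :: "'a set \<Rightarrow> ('a \<Rightarrow> 'a) \<Rightarrow> ('a \<times> 'a) set" where "graph E g = (\<lambda>x. (x, g x)) ` E" for E g
  define ext where "ext E g \<longleftrightarrow> subfield E L \<and> F \<subseteq> E \<and> g \<in> ring_hom (L \<lparr> carrier := E \<rparr>) L \<and> (\<forall>a \<in> F. g a = h a)" for E g
  define A where "A = {graph E g | E g. ext E g}"
  have "\<exists>M \<in> A. \<forall>G \<in> A. M \<subseteq> G \<longrightarrow> G = M"
  proof (rule subset_Zorn_nonempty)
    show "A \<noteq> {}"
      using F h unfolding A_def ext_def by blast
  next
    fix C assume C: "C \<noteq> {}" "subset.chain A C"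
    define g where "g x = (THE y. (x, y) \<in> \<Union>C)" for x
    define E where "E = fst ` \<Union>C"
    have common: "\<exists>G \<in> C. u \<in> G \<and> v \<in> G" if uv: "u \<in> \<Union>C" "v \<in> \<Union>C" for u v
    proof -
      obtain G H where GH: "G \<in> C" "H \<in> C" "u \<in> G" "v \<in> H"
        using uv by blast
      then have "G \<subseteq> H \<or> H \<subseteq> G"
        using C(2) unfolding subset.chain_def by blast
      then show ?thesis
        using GH by blast
    qed
    \<comment> \<open>The union of the chain is single-valued: two pairs with the same first entry
      already lie in one graph. Hence the \<open>THE\<close> in the definition of \<open>g\<close>
      picks the value given by any member of the chain.\<close>
    have g_eq: "g x = g' x" if G: "graph E' g' \<in> C" and x: "x \<in> E'" for E' g' x
    proof -
      have "y = g' x" if xy: "(x, y) \<in> \<Union>C" for y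
      proof -
        have "(x, g' x) \<in> \<Union>C"
          using G x unfolding graph_def by blast
        then obtain H where H: "H \<in> C" "(x, y) \<in> H" "(x, g' x) \<in> H"
          using common[OF xy] by blast
        moreover have "H \<in> A"
          using H(1) C(2) unfolding subset.chain_def by blast
        ultimately show ?thesis
          unfolding A_def graph_def by auto
      qed
      then show ?thesis
        unfolding g_def using G x unfolding graph_def by (intro the_equality) blast+
    qed
    \<comment> \<open>The axioms of subfields and homomorphisms involve at most two elements at a
      time, so it is enough that any two elements of \<open>E\<close> lie in a member of the chain
      on which \<open>g\<close> itself is an admissible extension.\<close>
    have cover: "\<exists>E'. x \<in> E' \<and> y \<in> E' \<and> E' \<subseteq> E \<and> graph E' g \<in> C \<and> ext E' g" if xy: "x \<in> E" "y \<in> E" for x y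
    proof -
      obtain x' y' where "(x, x') \<in> \<Union>C" "(y, y') \<in> \<Union>C"
        using xy unfolding E_def by force
      then obtain G where G: "G \<in> C" "(x, x') \<in> G" "(y, y') \<in> G"
        using common by blast
      moreover have "G \<in> A"
        using G(1) C(2) unfolding subset.chain_def by blast
      then obtain E' g' where E': "G = graph E' g'" "ext E' g'"
        unfolding A_def by blast
      have eq: "g z = g' z" if "z \<in> E'" for z
        using g_eq G(1) that unfolding E'(1) by blast
      have "ext E' g"
        unfolding ext_def
      proof (intro conjI)
        show "subfield E' L" and FE: "F \<subseteq> E'" and "\<forall>a \<in> F. g a = h a"
          using E'(2) eq unfolding ext_def by auto
        have g': "g' \<in> ring_hom (L \<lparr> carrier := E' \<rparr>) L" and "subring E' L"
          using E'(2) subfieldE(1) unfolding ext_def by auto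
        then show "g \<in> ring_hom (L \<lparr> carrier := E' \<rparr>) L"
          using eq subringE[OF \<open>subring E' L\<close>] ring_hom_memE[OF g']
          by (intro ring_hom_memI) auto
      qed
      moreover have "graph E' g = graph E' g'"
        unfolding graph_def using eq by auto
      moreover have "x \<in> E'" "y \<in> E'"
        using G unfolding E'(1) graph_def by auto
      moreover have "E' \<subseteq> E"
        using G(1) unfolding E'(1) E_def graph_def by force
      ultimately show ?thesis
        using G(1) E'(1) by metis
    qed
    have "ext E g"
      unfolding ext_def
    proof (intro conjI)
      obtain G where "G \<in> C"
        using C(1) by blast
      then obtain E' g' where E': "graph E' g' \<in> C" "ext E' g'"
        using C(2) unfolding subset.chain_def A_def by blast
      have "E' \<subseteq> E"
        using E'(1) unfolding E_def graph_def by force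
      then show FE: "F \<subseteq> E"
        using E'(2) unfolding ext_def by blast
      show "\<forall>a \<in> F. g a = h a"
        using E' g_eq unfolding ext_def by (metis subsetD)
      note sub = subringE[OF subfieldE(1)]
      show "subfield E L"
      proof (rule subfieldI'[OF subringI])
        show "E \<subseteq> carrier L"
          using cover subfieldE(3) unfolding ext_def by blast
        show "\<one> \<in> E"
          using FE sub(3)[OF F] by blast
        fix x y assume xy: "x \<in> E" "y \<in> E"
        obtain E' where E': "x \<in> E'" "y \<in> E'" "E' \<subseteq> E" "subfield E' L"
          using cover[OF xy] unfolding ext_def by blast
        have "\<ominus> x \<in> E'" "x \<otimes> y \<in> E'" "x \<oplus> y \<in> E'"
          using sub(5)[OF E'(4,1)] sub(6,7)[OF E'(4,1,2)] by simp_all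
        then show "\<ominus> x \<in> E" "x \<otimes> y \<in> E" "x \<oplus> y \<in> E"
          using E'(3) by auto
      next
        fix x assume x: "x \<in> E - {\<zero>}"
        then obtain E' where E': "x \<in> E'" "E' \<subseteq> E" "subfield E' L"
          using cover[of x x] unfolding ext_def by blast
        then show "inv x \<in> E"
          using subfield_m_inv(1)[OF E'(3), of x] x by blast
      qed
      have *: "g x \<in> carrier L \<and> g (x \<otimes> y) = g x \<otimes> g y \<and> g (x \<oplus> y) = g x \<oplus> g y \<and> g \<one> = \<one>" if xy: "x \<in> E" "y \<in> E" for x y
      proof -
        obtain E' where E': "x \<in> E'" "y \<in> E'" "g \<in> ring_hom (L \<lparr> carrier := E' \<rparr>) L"
          using cover[OF xy] unfolding ext_def by blast
        then show ?thesis
          using ring_hom_memE[OF E'(3)] by auto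
      qed
      moreover have "\<one> \<in> E"
        using FE sub(3)[OF F] by blast
      ultimately show "g \<in> ring_hom (L \<lparr> carrier := E \<rparr>) L"
        by (intro ring_hom_memI) auto
    qed
    moreover have "graph E g = \<Union>C"
    proof
      show "graph E g \<subseteq> \<Union>C"
        using cover unfolding graph_def by blast
      show "\<Union>C \<subseteq> graph E g"
      proof
        fix u assume "u \<in> \<Union>C"
        then obtain G where G: "G \<in> C" "u \<in> G"
          by blast
        then obtain E' g' where E': "G = graph E' g'"
          using C(2) unfolding subset.chain_def A_def by blast
        then obtain x where x: "x \<in> E'" "u = (x, g' x)"
          using G(2) unfolding graph_def by blast
        have "fst u \<in> E"
          using G unfolding E_def by blast
        moreover have "g x = g' x"
          using g_eq[of E' g' x] G(1) E' x(1) by simp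
        ultimately show "u \<in> graph E g"
          using x(2) unfolding graph_def by (simp add: image_iff)
      qed
    qed
    ultimately show "\<Union>C \<in> A"
      unfolding A_def by blast
  qed
  then obtain M where M: "M \<in> A" and M_max: "\<And>G. G \<in> A \<Longrightarrow> M \<subseteq> G \<Longrightarrow> G = M"
    by blast
  obtain E g where E: "ext E g" "M = graph E g"
    using M unfolding A_def by blast
  have max: "graph E' g' = graph E g" if "ext E' g'" "graph E g \<subseteq> graph E' g'" for E' g'
    using M_max[of "graph E' g'"] that unfolding E(2) A_def by blast
  have sE: "subfield E L" and g: "g \<in> ring_hom (L \<lparr> carrier := E \<rparr>) L" and FE: "F \<subseteq> E"
    and gh: "\<And>a. a \<in> F \<Longrightarrow> g a = h a"
    using E(1) unfolding ext_def by auto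
  \<comment> \<open>Maximality is used here: the extension of \<open>g\<close> to E(x) has a graph
    containing that of \<open>g\<close>, so the graphs coincide, and comparing first entries gives
    E(x) = E.\<close>
  have "carrier L \<subseteq> E"
  proof
    fix x assume x: "x \<in> carrier L"
    have "(algebraic over K) x"
      using algebraic_extension[OF x] .
    then have alg: "(algebraic over E) x"
      using algebraic_mono[of K E x] KF FE by blast
    obtain y where y: "y \<in> carrier L" "eval (map g (Irr E x)) y = \<zero>"
      using map_Irr_has_root[OF sE g x alg] .
    obtain g' where g': "g' \<in> ring_hom (L \<lparr> carrier := simple_extension E x \<rparr>) L" "\<And>a. a \<in> E \<Longrightarrow> g' a = g a"
      using hom_extend_simple_extension[OF sE x alg g y] by blast
    have incl: "E \<subseteq> simple_extension E x"
      using simple_extension_incl[OF subfieldE(3)[OF sE] x] .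
    have "ext (simple_extension E x) g'"
      unfolding ext_def using simple_extension_is_subfield[OF sE x] alg g' incl FE gh by auto
    moreover have "graph E g \<subseteq> graph (simple_extension E x) g'"
      using incl g'(2) unfolding graph_def by force
    ultimately have "graph (simple_extension E x) g' = graph E g"
      by (rule max)
    then have "fst ` graph (simple_extension E x) g' = fst ` graph E g"
      by simp
    then have "simple_extension E x = E"
      unfolding graph_def by (simp add: image_image)
    then show "x \<in> E"
      using simple_extension_mem[OF subfieldE(1)[OF sE] x] by simp
  qed
  then have "E = carrier L"
    using subfieldE(3)[OF sE] by blast
  then show ?thesis
    using g gh by auto
qed

section \<open>Automorphisms over a subfield\<close>

text \<open>Values outside the carrier are unconstrained, so many functions in \<open>Gal F\<close>
  may represent the same automorphism. Counting is therefore only done for images or restrictions,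
  never for \<open>Gal F\<close> itself.\<close>

definition (in ring) Gal :: "'a set \<Rightarrow> ('a \<Rightarrow> 'a) set"
  where "Gal F = {g \<in> ring_iso R R. \<forall>x \<in> F. g x = x}"

lemma (in ring) GalD:
  assumes "g \<in> Gal F"
  shows "g \<in> ring_hom R R" and "bij_betw g (carrier R) (carrier R)"
    and "x \<in> F \<Longrightarrow> g x = x" and "x \<in> carrier R \<Longrightarrow> g x \<in> carrier R"
  using assms ring_iso_memE(1)[of g R R x] unfolding Gal_def ring_iso_def by auto

lemma (in ring) Gal_inj:
  assumes "g \<in> Gal F" "x \<in> carrier R" "y \<in> carrier R" "g x = g y"
  shows "x = y"
  using GalD(2)[OF assms(1)] assms(2-4) unfolding bij_betw_def inj_on_def by blast

lemma (in ring) Gal_antimono: "F \<subseteq> E \<Longrightarrow> Gal E \<subseteq> Gal F"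
  unfolding Gal_def by blast

lemma (in ring) id_in_Gal: "id \<in> Gal F"
  unfolding Gal_def by (simp add: ring_iso_set_refl)

lemma (in ring) Gal_comp: "g \<in> Gal F \<Longrightarrow> h \<in> Gal F \<Longrightarrow> g \<circ> h \<in> Gal F"
  unfolding Gal_def using ring_iso_set_trans[of h R R g R] by auto

lemma (in ring) Gal_inv:
  assumes g: "g \<in> Gal F" and F: "F \<subseteq> carrier R"
  shows "inv_into (carrier R) g \<in> Gal F"
    and "x \<in> carrier R \<Longrightarrow> inv_into (carrier R) g (g x) = x"
    and "x \<in> carrier R \<Longrightarrow> g (inv_into (carrier R) g x) = x"
proof -
  show inv: "inv_into (carrier R) g (g x) = x" if "x \<in> carrier R" for x
    using bij_betw_inv_into_left[OF GalD(2)[OF g] that] .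
  show "x \<in> carrier R \<Longrightarrow> g (inv_into (carrier R) g x) = x"
    using bij_betw_inv_into_right[OF GalD(2)[OF g]] .
  have "inv_into (carrier R) g x = x" if "x \<in> F" for x
  proof -
    have "x \<in> carrier R"
      using that F by blast
    from inv[OF this] show ?thesis
      unfolding GalD(3)[OF g that] .
  qed
  then show "inv_into (carrier R) g \<in> Gal F"
    using ring_iso_set_sym[OF ring_axioms, of g R] g unfolding Gal_def by simp
qed

lemma (in ring) Gal_ring_hom_ring: "g \<in> Gal F \<Longrightarrow> ring_hom_ring R R g"
  using ring_hom_ringI2[OF ring_axioms ring_axioms GalD(1)] .

lemma (in domain) Gal_eval:
  assumes g: "g \<in> Gal F" and F: "subring F R" and x: "x \<in> carrier R" and p: "p \<in> carrier (F[X])"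
  shows "g (eval p x) = eval p (g x)"
proof -
  have "set p \<subseteq> F"
    using p polynomial_incl unfolding univ_poly_carrier[symmetric] by blast
  then have "map g p = p"
    using GalD(3)[OF g] by (intro map_idI) blast
  then show ?thesis
    using ring_hom_ring.eval_hom[OF Gal_ring_hom_ring[OF g] F x p] by simp
qed

section \<open>Conjugates of an element and separability\<close>

text \<open>Allows every result about the base field \<open>K\<close> to be reused over each
  intermediate field of a tower.\<close>

lemma (in algebraic_closure) intermediate_closure:
  assumes "subfield F L" "K \<subseteq> F"
  shows "algebraic_closure L F"
proof (intro algebraic_closure.intro algebraic_closure_axioms.intro)
  show "field L" "subfield F L"
    using field_axioms assms(1) .
  show "(algebraic over F) x" if "x \<in> carrier L" for x
    using algebraic_mono[OF assms(2)] algebraic_extension[OF that] .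
  show "splitted P" if "P \<in> carrier (F[X])" for P
    using roots_over_carrier[OF carrier_polynomial_shell[OF subfieldE(1)[OF assms(1)] that]] .
qed

lemma (in algebraic_closure) Irr_props:
  assumes "x \<in> carrier L"
  shows "Irr K x \<in> carrier (K[X])" "Irr K x \<in> carrier (poly_ring L)" "pirreducible K (Irr K x)"
    "lead_coeff (Irr K x) = \<one>" "eval (Irr K x) x = \<zero>" "Irr K x \<noteq> []" "degree (Irr K x) \<ge> 1"
proof -
  note Irr = IrrE[OF subfield_axioms assms algebraic_extension[OF assms]]
  show "Irr K x \<in> carrier (K[X])" "pirreducible K (Irr K x)"
    "lead_coeff (Irr K x) = \<one>" "eval (Irr K x) x = \<zero>"
    using Irr by simp_all
  show "Irr K x \<in> carrier (poly_ring L)"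
    using carrier_polynomial_shell[OF subfieldE(1)[OF subfield_axioms] Irr(1)] .
  show "degree (Irr K x) \<ge> 1"
    using pirreducible_degree[OF subfield_axioms Irr(1,2)] .
  then show "Irr K x \<noteq> []"
    by auto
qed

text \<open>Injectivity is automatic for fields. For surjectivity at \<open>y\<close>, the finite
  set of roots of \<open>Irr K y\<close> is mapped injectively into itself, hence onto itself, and
  it contains \<open>y\<close>.\<close>

lemma (in algebraic_closure) hom_in_Gal:
  assumes g: "g \<in> ring_hom L L" and fixK: "\<And>a. a \<in> K \<Longrightarrow> g a = a"
  shows "g \<in> Gal K"
proof -
  have inj: "inj_on g (carrier L)"
    using non_trivial_field_hom_is_inj[OF g field_axioms field_axioms] .
  have "y \<in> g ` carrier L" if y: "y \<in> carrier L" for y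
  proof -
    let ?S = "{x. is_root (Irr K y) x}"
    have fin: "finite ?S"
      using finite_number_of_roots[OF Irr_props(2)[OF y]] .
    have "set (Irr K y) \<subseteq> K"
      using Irr_props(1)[OF y] polynomial_incl unfolding univ_poly_carrier[symmetric] by blast
    then have "map g (Irr K y) = Irr K y"
      using fixK by (intro map_idI) blast
    then have hom: "eval (Irr K y) (g x) = g (eval (Irr K y) x)" if "x \<in> carrier L" for x
      using ring_hom_ring.eval_hom[OF ring_hom_ringI2[OF ring_axioms ring_axioms g]
          carrier_is_subring that Irr_props(2)[OF y]] by simp
    have "g \<zero> = \<zero>"
      using ring_hom_zero[OF g ring_axioms ring_axioms] .
    then have "g ` ?S \<subseteq> ?S"
      using hom ring_hom_memE(1)[OF g] unfolding is_root_def by auto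
    moreover have "inj_on g ?S"
      using inj unfolding inj_on_def is_root_def by blast
    ultimately have "g ` ?S = ?S"
      using endo_inj_surj[OF fin] by blast
    moreover have "y \<in> ?S"
      using Irr_props(5,6)[OF y] y unfolding is_root_def by blast
    ultimately have "y \<in> g ` ?S"
      by simp
    then show ?thesis
      unfolding is_root_def by blast
  qed
  then have "bij_betw g (carrier L) (carrier L)"
    using inj ring_hom_memE(1)[OF g] unfolding bij_betw_def by blast
  then show ?thesis
    using g fixK unfolding Gal_def ring_iso_def by blast
qed

text \<open>Automorphisms over \<open>K\<close> send roots to roots. Conversely, for a root
  \<open>y\<close> the identity of \<open>K\<close> extends to K(x) with \<open>x\<close> going to
  \<open>y\<close>, then to an endomorphism of \<open>L\<close>, which is an automorphism by
  \<open>hom_in_Gal\<close>.\<close>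

lemma (in algebraic_closure) Gal_orbit:
  assumes x: "x \<in> carrier L"
  shows "(\<lambda>g. g x) ` Gal K = {y. is_root (Irr K x) y}"
proof (intro equalityI subsetI)
  fix y assume "y \<in> (\<lambda>g. g x) ` Gal K"
  then obtain g where g: "g \<in> Gal K" "y = g x"
    by blast
  have "eval (Irr K x) (g x) = g \<zero>"
    using Gal_eval[OF g(1) subfieldE(1)[OF subfield_axioms] x Irr_props(1)[OF x]] Irr_props(5)[OF x] by simp
  also have "g \<zero> = \<zero>"
    using ring_hom_zero[OF GalD(1)[OF g(1)] ring_axioms ring_axioms] .
  finally show "y \<in> {y. is_root (Irr K x) y}"
    using g(2) Irr_props(6)[OF x] GalD(4)[OF g(1) x] unfolding is_root_def by simp
next
  fix y assume "y \<in> {y. is_root (Irr K x) y}"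
  then have y: "y \<in> carrier L" "eval (Irr K x) y = \<zero>"
    unfolding is_root_def by auto
  have KL: "K \<subseteq> carrier L"
    using subfieldE(3)[OF subfield_axioms] .
  have id: "id \<in> ring_hom (L \<lparr> carrier := K \<rparr>) L"
    using KL by (intro ring_hom_memI) auto
  have alg: "(algebraic over K) x"
    using algebraic_extension[OF x] .
  obtain h where h: "h \<in> ring_hom (L \<lparr> carrier := simple_extension K x \<rparr>) L"
    "\<And>a. a \<in> K \<Longrightarrow> h a = id a" "h x = y"
    using hom_extend_simple_extension[OF subfield_axioms x alg id y(1)] y(2) by auto
  have incl: "K \<subseteq> simple_extension K x"
    using simple_extension_incl[OF KL x] .
  obtain g where g: "g \<in> ring_hom L L" "\<And>a. a \<in> simple_extension K x \<Longrightarrow> g a = h a"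
    using hom_extend_closure[OF _ incl h(1)] simple_extension_is_subfield[OF subfield_axioms x] alg by blast
  have "g a = a" if "a \<in> K" for a
    using g(2)[of a] h(2)[OF that] incl that by auto
  then have "g \<in> Gal K"
    by (rule hom_in_Gal[OF g(1)])
  moreover have "g x = y"
    using g(2) h(3) simple_extension_mem[OF subfieldE(1)[OF subfield_axioms] x] by simp
  ultimately show "y \<in> (\<lambda>g. g x) ` Gal K"
    by blast
qed

text \<open>The size is the sum of the multiplicities over the support, where each is at least 1; it
  equals the number of summands only if each is exactly 1.\<close>

lemma size_eq_card_set_mset_iff:
  "size M = card (set_mset M) \<longleftrightarrow> (\<forall>a. count M a \<le> 1)"
proof -
  have "(\<forall>a. count M a \<le> 1) \<longleftrightarrow> (\<forall>a \<in> set_mset M. count M a = 1)"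
    by (metis count_eq_zero_iff count_greater_eq_one_iff dual_order.antisym le_numeral_extra(1) nle_le zero_le)
  also have "\<dots> \<longleftrightarrow> sum (count M) (set_mset M) = sum (\<lambda>_. 1) (set_mset M)"
    using sum_mono_inv[of "\<lambda>_. 1" "set_mset M" "count M"] by (auto simp del: sum_constant)
  finally show ?thesis
    by (simp add: size_multiset_overloaded_eq)
qed

text \<open>As \<open>Irr K x\<close> splits over \<open>L\<close>, its degree counts its roots with
  multiplicity, while the orbit of \<open>x\<close> counts them without. The two agree exactly when
  no root is multiple.\<close>

lemma (in algebraic_closure) Gal_orbit_card:
  assumes x: "x \<in> carrier L"
  shows "finite ((\<lambda>g. g x) ` Gal K)"
    and "card ((\<lambda>g. g x) ` Gal K) \<le> degree (Irr K x)"
    and "separable_elem L K x \<longleftrightarrow> card ((\<lambda>g. g x) ` Gal K) = degree (Irr K x)"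
proof -
  let ?M = "roots (Irr K x)"
  note p = Irr_props(2)[OF x]
  have orbit: "(\<lambda>g. g x) ` Gal K = set_mset ?M"
    using Gal_orbit[OF x] roots_mem_iff_is_root[OF p] by blast
  have deg: "degree (Irr K x) = size ?M"
    using roots_over_carrier[OF p] unfolding splitted_def by simp
  show "finite ((\<lambda>g. g x) ` Gal K)" "card ((\<lambda>g. g x) ` Gal K) \<le> degree (Irr K x)"
    unfolding orbit deg by (simp_all add: size_multiset_overloaded_eq card_eq_sum sum_mono del: sum_constant)
  have "separable_elem L K x \<longleftrightarrow> (\<forall>a \<in> carrier L. count ?M a \<le> 1)"
    using algebraic_extension[OF x] alg_mult_eq_count_roots[OF p] unfolding separable_elem_def over_def by simp
  also have "\<dots> \<longleftrightarrow> (\<forall>a. count ?M a \<le> 1)"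
    using roots_mem_iff_is_root[OF p] unfolding is_root_def by (metis not_in_iff zero_le)
  finally show "separable_elem L K x \<longleftrightarrow> card ((\<lambda>g. g x) ` Gal K) = degree (Irr K x)"
    unfolding orbit deg using size_eq_card_set_mset_iff[of ?M] by auto
qed

section \<open>Separable degree and separable elements\<close>

text \<open>
  Automorphisms are counted up to their values on \<open>E\<close>; since all embeddings of \<open>E\<close> over \<open>F\<close> extend
  to automorphisms of an algebraic closure, this is the number of embeddings.
\<close>

definition (in ring) sep_degree :: "'a set \<Rightarrow> 'a set \<Rightarrow> nat"
  where "sep_degree F E = card ((\<lambda>g. restrict g E) ` Gal F)"

section \<open>Multiplicativity in towers and comparison with the degree\<close>

text \<open>This is a coset decomposition: fix one lift in \<open>Gal F\<close> of each restriction
  \<phi> to \<open>M\<close>. Every restriction to \<open>E\<close> is then uniquely the lift of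
  some \<phi> after some \<psi> that fixes \<open>M\<close>.\<close>

lemma (in ring) sep_degree_mult:
  assumes FM: "F \<subseteq> M" and ME: "M \<subseteq> E" and E: "E \<subseteq> carrier R"
  shows "sep_degree F E = sep_degree F M * sep_degree M E"
proof -
  let ?res = "\<lambda>E g. restrict g E"
  have "\<forall>\<phi> \<in> ?res M ` Gal F. \<exists>g. g \<in> Gal F \<and> restrict g M = \<phi>"
    by blast
  then obtain lift where "\<forall>\<phi> \<in> ?res M ` Gal F. lift \<phi> \<in> Gal F \<and> restrict (lift \<phi>) M = \<phi>"
    using bchoice[of "?res M ` Gal F" "\<lambda>\<phi> g. g \<in> Gal F \<and> restrict g M = \<phi>"] by blast
  then have lift: "lift (restrict g M) \<in> Gal F" "restrict (lift (restrict g M)) M = restrict g M"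
    if "g \<in> Gal F" for g
    using that by blast+
  have FR: "F \<subseteq> carrier R" and MR: "M \<subseteq> carrier R"
    using FM ME E by blast+
  have "bij_betw (\<lambda>(\<phi>, \<psi>). restrict (lift \<phi> \<circ> \<psi>) E) (?res M ` Gal F \<times> ?res E ` Gal M) (?res E ` Gal F)"
    unfolding bij_betw_def
  proof
    show "inj_on (\<lambda>(\<phi>, \<psi>). restrict (lift \<phi> \<circ> \<psi>) E) (?res M ` Gal F \<times> ?res E ` Gal M)"
    proof (rule inj_onI, clarify)
      fix g1 g2 h1 h2
      assume g: "g1 \<in> Gal F" "g2 \<in> Gal F" and h: "h1 \<in> Gal M" "h2 \<in> Gal M"
      let ?l1 = "lift (restrict g1 M)" and ?l2 = "lift (restrict g2 M)"
      assume res_eq: "restrict (?l1 \<circ> restrict h1 E) E = restrict (?l2 \<circ> restrict h2 E) E"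
      have eq: "?l1 (h1 x) = ?l2 (h2 x)" if "x \<in> E" for x
        using fun_cong[OF res_eq, of x] that by simp
      have l: "?l1 \<in> Gal F" "restrict ?l1 M = restrict g1 M" "restrict ?l2 M = restrict g2 M"
        using lift g by blast+
      \<comment> \<open>On \<open>M\<close> the second components are the identity, so the lifts
        agree there and the first components are equal. The lifts are then the same function, which
        can be cancelled because it is injective.\<close>
      have "g1 x = g2 x" if x: "x \<in> M" for x
      proof -
        have "?l1 x = ?l2 x"
          using eq[of x] GalD(3)[OF h(1) x] GalD(3)[OF h(2) x] x ME by auto
        then show ?thesis
          using x fun_cong[OF l(2), of x] fun_cong[OF l(3), of x] by simp
      qed
      then have res: "restrict g1 M = restrict g2 M"
        by (intro restrict_ext) simp
      moreover have "h1 x = h2 x" if x: "x \<in> E" for x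
      proof (rule Gal_inj[OF l(1)])
        show "h1 x \<in> carrier R" "h2 x \<in> carrier R"
          using GalD(4)[OF h(1)] GalD(4)[OF h(2)] x E by auto
        show "?l1 (h1 x) = ?l1 (h2 x)"
          using eq[OF x] unfolding res .
      qed
      then have "restrict h1 E = restrict h2 E"
        by (intro restrict_ext) simp
      ultimately show "restrict g1 M = restrict g2 M \<and> restrict h1 E = restrict h2 E"
        by simp
    qed
  next
    show "(\<lambda>(\<phi>, \<psi>). restrict (lift \<phi> \<circ> \<psi>) E) ` (?res M ` Gal F \<times> ?res E ` Gal M) = ?res E ` Gal F"
    proof (intro equalityI subsetI)
      fix f assume "f \<in> (\<lambda>(\<phi>, \<psi>). restrict (lift \<phi> \<circ> \<psi>) E) ` (?res M ` Gal F \<times> ?res E ` Gal M)"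
      then obtain g h where gh: "g \<in> Gal F" "h \<in> Gal M" "f = restrict (lift (restrict g M) \<circ> restrict h E) E"
        by auto
      have "f = restrict (lift (restrict g M) \<circ> h) E"
        unfolding gh(3) by (intro restrict_ext) simp
      moreover have "lift (restrict g M) \<circ> h \<in> Gal F"
        using lift(1) gh(1,2) Gal_antimono[OF FM] by (intro Gal_comp) blast+
      ultimately show "f \<in> ?res E ` Gal F"
        by blast
    next
      fix f assume "f \<in> ?res E ` Gal F"
      then obtain g where g: "g \<in> Gal F" "f = restrict g E"
        by blast
      \<comment> \<open>The lift agrees with \<open>g\<close> on \<open>M\<close>, so its inverse
        composed with \<open>g\<close> fixes \<open>M\<close> and serves as second
        component.\<close>
      let ?l = "lift (restrict g M)"
      let ?h = "inv_into (carrier R) ?l \<circ> g"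
      have l: "?l \<in> Gal F" "restrict ?l M = restrict g M"
        using lift g(1) by blast+
      note linv = Gal_inv[OF l(1) FR]
      have "?h \<in> Gal F"
        using Gal_comp[OF linv(1) g(1)] .
      moreover have "?h x = x" if x: "x \<in> M" for x
      proof -
        have "?l x = g x"
          using fun_cong[OF l(2), of x] x by simp
        then show ?thesis
          using linv(2)[of x] x MR by auto
      qed
      ultimately have h: "?h \<in> Gal M"
        unfolding Gal_def by blast
      have "?l (?h x) = g x" if x: "x \<in> E" for x
        using linv(3)[of "g x"] GalD(4)[OF g(1), of x] x E by auto
      then have "f = restrict (?l \<circ> restrict ?h E) E"
        unfolding g(2) by (intro restrict_ext) simp
      then have "f = (\<lambda>(\<phi>, \<psi>). restrict (lift \<phi> \<circ> \<psi>) E) (restrict g M, restrict ?h E)"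
        by simp
      then show "f \<in> (\<lambda>(\<phi>, \<psi>). restrict (lift \<phi> \<circ> \<psi>) E) ` (?res M ` Gal F \<times> ?res E ` Gal M)"
        using g(1) h by blast
    qed
  qed
  from bij_betw_same_card[OF this] show ?thesis
    unfolding sep_degree_def by (simp add: card_cartesian_product)
qed

text \<open>Elements of K(x) are values at \<open>x\<close> of polynomials over \<open>K\<close>, so
  an automorphism over \<open>K\<close> is determined on K(x) by its value at
  \<open>x\<close>.\<close>

lemma (in algebraic_closure) sep_degree_simple_extension:
  assumes x: "x \<in> carrier L"
  shows "sep_degree K (simple_extension K x) = card ((\<lambda>g. g x) ` Gal K)"
proof -
  let ?E = "simple_extension K x"
  have KR: "subring K L"
    using subfieldE(1)[OF subfield_axioms] .
  have xE: "x \<in> ?E"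
    using simple_extension_mem[OF KR x] .
  have img: "?E = (\<lambda>p. eval p x) ` carrier (K[X])"
    using simple_extension_as_eval_img[OF subringE(1)[OF KR] x] .
  have "inj_on (\<lambda>\<phi>. \<phi> x) ((\<lambda>g. restrict g ?E) ` Gal K)"
  proof (rule inj_onI, clarify)
    fix g h assume g: "g \<in> Gal K" and h: "h \<in> Gal K" and "restrict g ?E x = restrict h ?E x"
    then have "g x = h x"
      using xE by simp
    then have "g a = h a" if "a \<in> ?E" for a
      using that Gal_eval[OF g KR x] Gal_eval[OF h KR x] unfolding img by auto
    then show "restrict g ?E = restrict h ?E"
      by (intro restrict_ext) simp
  qed
  then have "sep_degree K ?E = card ((\<lambda>\<phi>. \<phi> x) ` (\<lambda>g. restrict g ?E) ` Gal K)"
    unfolding sep_degree_def by (simp add: card_image)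
  also have "(\<lambda>\<phi>. \<phi> x) ` (\<lambda>g. restrict g ?E) ` Gal K = (\<lambda>g. g x) ` Gal K"
    using xE by (simp add: image_image)
  finally show ?thesis .
qed

lemma (in algebraic_closure) simple_extension_props:
  assumes x: "x \<in> carrier L"
  shows "subfield (simple_extension K x) L" "K \<subseteq> simple_extension K x" "x \<in> simple_extension K x"
    "finite_dimension K (simple_extension K x)"
    "(dim over K) (simple_extension K x) = degree (Irr K x)"
    "(dim over K) (simple_extension K x) > 0"
proof -
  note K = subfield_axioms and alg = algebraic_extension[OF x]
  show "subfield (simple_extension K x) L"
    using simple_extension_is_subfield[OF K x] alg by blast
  show "K \<subseteq> simple_extension K x"
    using simple_extension_incl[OF subfieldE(3)[OF K] x] .
  show "x \<in> simple_extension K x"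
    using simple_extension_mem[OF subfieldE(1)[OF K] x] .
  show "finite_dimension K (simple_extension K x)"
    using finite_dimensionI[OF dimension_simple_extension[OF K x alg]] .
  show dim: "(dim over K) (simple_extension K x) = degree (Irr K x)"
    using simple_extension_dim[OF K x alg] .
  show "(dim over K) (simple_extension K x) > 0"
    unfolding dim using Irr_props(7)[OF x] by simp
qed

lemma (in algebraic_closure) sep_degree_simple_extension_dim:
  assumes x: "x \<in> carrier L"
  shows "sep_degree K (simple_extension K x) \<le> (dim over K) (simple_extension K x)"
    and "separable_elem L K x \<longleftrightarrow>
      sep_degree K (simple_extension K x) = (dim over K) (simple_extension K x)"
  using Gal_orbit_card[OF x] unfolding sep_degree_simple_extension[OF x] simple_extension_props(5)[OF x]
  by simp_all

section \<open>The field of separable elements\<close>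

text \<open>The minimal polynomial over the larger field divides the one over \<open>K\<close>, so
  its roots form a submultiset and multiplicities can only drop.\<close>

lemma (in algebraic_closure) separable_elem_mono:
  assumes F: "subfield F L" "K \<subseteq> F" and x: "x \<in> carrier L" and sep: "separable_elem L K x"
  shows "separable_elem L F x"
proof -
  interpret F: algebraic_closure L F
    using intermediate_closure[OF F] .
  have "Irr K x \<in> carrier (F[X])"
    using Irr_props(1)[OF x] F(2) unfolding univ_poly_carrier[symmetric] polynomial_def by blast
  then have "Irr F x pdivides Irr K x"
    using Irr_minimal[OF F(1) x F.algebraic_extension[OF x]] Irr_props(5)[OF x] by simp
  then have incl: "roots (Irr F x) \<subseteq># roots (Irr K x)"
    using pdivides_imp_roots_incl[OF F.Irr_props(2)[OF x] Irr_props(2,6)[OF x]] by simp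
  have "alg_mult (Irr F x) a \<le> 1" if "a \<in> carrier L" for a
  proof -
    have "alg_mult (Irr F x) a \<le> alg_mult (Irr K x) a"
      unfolding alg_mult_eq_count_roots[OF F.Irr_props(2)[OF x]] alg_mult_eq_count_roots[OF Irr_props(2)[OF x]]
      using mset_subset_eq_count[OF incl] .
    also have "\<dots> \<le> 1"
      using sep that unfolding separable_elem_def by blast
    finally show ?thesis .
  qed
  then show ?thesis
    using F.algebraic_extension[OF x] unfolding separable_elem_def over_def by blast
qed

text \<open>Two towers from \<open>K\<close> to E = K(a,b) are compared: through K(a), where
  separable degree and degree agree at both steps, and through K(c), where every step satisfies only
  an inequality. Equality at the top then leaves no room for a defect at K(c).\<close>

lemma (in algebraic_closure) separable_elem_generated:
  assumes ab: "a \<in> carrier L" "b \<in> carrier L"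
    and sep: "separable_elem L K a" "separable_elem L K b"
    and c: "c \<in> simple_extension (simple_extension K a) b"
  shows "separable_elem L K c"
proof -
  let ?Ka = "simple_extension K a" and ?M = "simple_extension K c"
  let ?E = "simple_extension ?Ka b" and ?Ma = "simple_extension ?M a"
  note Ka = simple_extension_props[OF ab(1)]
  interpret Ka: algebraic_closure L ?Ka
    using intermediate_closure[OF Ka(1,2)] .
  note E = Ka.simple_extension_props[OF ab(2)]
  have EL: "?E \<subseteq> carrier L"
    using subfieldE(3)[OF E(1)] .
  then have cL: "c \<in> carrier L"
    using c by blast
  note M = simple_extension_props[OF cL]
  interpret M: algebraic_closure L ?M
    using intermediate_closure[OF M(1,2)] .
  note Ma = M.simple_extension_props[OF ab(1)]
  interpret Ma: algebraic_closure L ?Ma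
    using M.intermediate_closure[OF Ma(1,2)] .
  note Mab = Ma.simple_extension_props[OF ab(2)]
  have ME: "?M \<subseteq> ?E"
    using simple_extension_subring_incl[OF subfieldE(1)[OF E(1)] _ c] Ka(2) E(2) by blast
  \<comment> \<open>The bound of the separable degree by the degree is available only for simple
    extensions. Since \<open>a\<close> and \<open>b\<close> generate \<open>?E\<close> over K(c) as
    well, two simple steps suffice.\<close>
  have E_eq: "simple_extension ?Ma b = ?E"
  proof
    have "?Ma \<subseteq> ?E"
      using simple_extension_subring_incl[OF subfieldE(1)[OF E(1)] ME] Ka(3) E(2) by blast
    then show "simple_extension ?Ma b \<subseteq> ?E"
      using simple_extension_subring_incl[OF subfieldE(1)[OF E(1)]] E(3) by blast
    have "?Ka \<subseteq> ?Ma"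
      using mono_simple_extension[OF M(2)] .
    then show "?E \<subseteq> simple_extension ?Ma b"
      by (rule mono_simple_extension)
  qed
  note Mab = Mab[unfolded E_eq]
  have sepE: "sep_degree K ?E = (dim over K) ?E"
  proof -
    have "sep_degree K ?E = sep_degree K ?Ka * sep_degree ?Ka ?E"
      using sep_degree_mult[OF Ka(2) E(2) EL] .
    also have "\<dots> = (dim over K) ?Ka * (dim over ?Ka) ?E"
      using sep_degree_simple_extension_dim(2)[OF ab(1)] sep(1)
        Ka.sep_degree_simple_extension_dim(2)[OF ab(2)] separable_elem_mono[OF Ka(1,2) ab(2) sep(2)] by simp
    also have "\<dots> = (dim over K) ?E"
      using telescopic_base_dim(2)[OF subfield_axioms Ka(1,4) E(4)] by simp
    finally show ?thesis .
  qed
  have sepM: "sep_degree ?M ?E \<le> (dim over ?M) ?E"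
  proof -
    have "sep_degree ?M ?E = sep_degree ?M ?Ma * sep_degree ?Ma ?E"
      using sep_degree_mult[OF Ma(2) Mab(2) EL] .
    also have "\<dots> \<le> (dim over ?M) ?Ma * (dim over ?Ma) ?E"
      using M.sep_degree_simple_extension_dim(1)[OF ab(1)] Ma.sep_degree_simple_extension_dim(1)[OF ab(2)]
      unfolding E_eq by (rule mult_le_mono)
    also have "\<dots> = (dim over ?M) ?E"
      using telescopic_base_dim(2)[OF M(1) Ma(1,4) Mab(4)] by simp
    finally show ?thesis .
  qed
  have finM: "finite_dimension ?M ?E"
    using telescopic_base_dim(1)[OF M(1) Ma(1,4) Mab(4)] .
  \<comment> \<open>Both sides of the degree equation for \<open>?E\<close> are factored through
    \<open>?M\<close>; the positive factor \<open>(dim over ?M) ?E\<close> is cancelled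
    afterwards.\<close>
  have "(dim over K) ?M * (dim over ?M) ?E = (dim over K) ?E"
    using telescopic_base_dim(2)[OF subfield_axioms M(1,4) finM] by simp
  also have "\<dots> = sep_degree K ?M * sep_degree ?M ?E"
    using sep_degree_mult[OF M(2) ME EL] sepE by simp
  also have "\<dots> \<le> sep_degree K ?M * (dim over ?M) ?E"
    using sepM by simp
  finally have "(dim over K) ?M * (dim over ?M) ?E \<le> sep_degree K ?M * (dim over ?M) ?E" .
  moreover have "(dim over ?M) ?E > 0"
    using telescopic_base_dim(2)[OF M(1) Ma(1,4) Mab(4)] Ma(6) Mab(6) by simp
  ultimately have "(dim over K) ?M \<le> sep_degree K ?M"
    by simp
  then show ?thesis
    using sep_degree_simple_extension_dim[OF cL] by simp
qed

text \<open>The orbit of \<open>x\<close> is a single point, and K(x) = K makes the degree 1, so the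
  orbit criterion applies.\<close>

lemma (in algebraic_closure) separable_elem_base:
  assumes x: "x \<in> K"
  shows "separable_elem L K x"
proof -
  have xL: "x \<in> carrier L"
    using x subfieldE(3)[OF subfield_axioms] by blast
  have "(\<lambda>g. g x) ` Gal K = (\<lambda>_. x) ` Gal K"
    using GalD(3)[OF _ x] by (intro image_cong) simp_all
  also have "\<dots> = {x}"
    using id_in_Gal[of K] by blast
  finally have "(\<lambda>g. g x) ` Gal K = {x}" .
  moreover have "simple_extension K x = K"
    using simple_extension_props(2)[OF xL]
      simple_extension_subring_incl[OF subfieldE(1)[OF subfield_axioms] _ x, of K] by blast
  then have "degree (Irr K x) = 1"
    using simple_extension_props(5)[OF xL] dimI[OF subfield_axioms dimension_one[OF subfield_axioms]] by simp
  ultimately show ?thesis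
    using Gal_orbit_card(3)[OF xL] by simp
qed

text \<open>Sums, products and negatives of separable x, y lie in K(x,y), all of whose elements are
  separable.\<close>

lemma (in algebraic_closure) subfield_of_separables:
  assumes E: "subfield E L" and KE: "K \<subseteq> E"
  shows "subfield {x \<in> E. separable_elem L K x} L" (is "subfield ?S L")
proof (rule subfieldI'[OF subringI])
  note sub = subringE[OF subfieldE(1)[OF E]]
  show "?S \<subseteq> carrier L"
    using sub(1) by blast
  show "\<one> \<in> ?S"
    using separable_elem_base[OF subringE(3)[OF subfieldE(1)[OF subfield_axioms]]] sub(3) by blast
  have gen: "subfield (simple_extension (simple_extension K x) y) L \<and>
      x \<in> simple_extension (simple_extension K x) y \<and> y \<in> simple_extension (simple_extension K x) y \<and>
      (\<forall>z \<in> simple_extension (simple_extension K x) y. separable_elem L K z)"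
    if xy: "x \<in> ?S" "y \<in> ?S" for x y
  proof -
    have xL: "x \<in> carrier L" and yL: "y \<in> carrier L"
      using xy sub(1) by blast+
    note Kx = simple_extension_props[OF xL]
    interpret Kx: algebraic_closure L "simple_extension K x"
      using intermediate_closure[OF Kx(1,2)] .
    show ?thesis
      using Kx.simple_extension_props(1-3)[OF yL] Kx(3) separable_elem_generated[OF xL yL] xy by blast
  qed
  fix x y assume xy: "x \<in> ?S" "y \<in> ?S"
  let ?M = "simple_extension (simple_extension K x) y"
  have M: "subring ?M L" "x \<in> ?M" "y \<in> ?M" "\<And>z. z \<in> ?M \<Longrightarrow> separable_elem L K z"
    using gen[OF xy] subfieldE(1) by blast+
  have "\<ominus> x \<in> ?M" "x \<otimes> y \<in> ?M" "x \<oplus> y \<in> ?M"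
    using subringE(5)[OF M(1,2)] subringE(6,7)[OF M(1,2,3)] by simp_all
  moreover have "\<ominus> x \<in> E" "x \<otimes> y \<in> E" "x \<oplus> y \<in> E"
    using sub(5)[of x] sub(6,7)[of x y] xy by simp_all
  ultimately show "\<ominus> x \<in> ?S" "x \<otimes> y \<in> ?S" "x \<oplus> y \<in> ?S"
    using M(4) by simp_all
next
  fix x assume x: "x \<in> {x \<in> E. separable_elem L K x} - {\<zero>}"
  then have xL: "x \<in> carrier L"
    using subfieldE(3)[OF E] by blast
  note Kx = simple_extension_props[OF xL]
  interpret Kx: algebraic_closure L "simple_extension K x"
    using intermediate_closure[OF Kx(1,2)] .
  have "inv x \<in> simple_extension K x"
    using subfield_m_inv(1)[OF Kx(1), of x] Kx(3) x by blast
  \<comment> \<open>Adjoining \<open>x\<close> a second time brings the inverse into the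
    two-generator form of \<open>separable_elem_generated\<close>.\<close>
  then have "inv x \<in> simple_extension (simple_extension K x) x"
    using Kx.simple_extension_props(2)[OF xL] by blast
  then have "separable_elem L K (inv x)"
    using separable_elem_generated[OF xL xL] x by blast
  moreover have "inv x \<in> E"
    using subfield_m_inv(1)[OF E, of x] x by blast
  ultimately show "inv x \<in> {x \<in> E. separable_elem L K x}"
    by blast
qed

text \<open>\<open>GREATEST\<close> is meaningful only if a greatest candidate exists. The set of
  all separable elements of \<open>E\<close> is one: it is a field, and it contains every separable
  subextension.\<close>

lemma (in algebraic_closure) max_separable_subext_eq:
  assumes E: "subfield E L" "K \<subseteq> E"
  shows "max_separable_subext L K E = {x \<in> E. separable_elem L K x}"
  unfolding max_separable_subext_def
proof (rule Greatest_equality)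
  have "K \<subseteq> {x \<in> E. separable_elem L K x}"
    using separable_elem_base E(2) by blast
  then show "intermediate_field L K E {x \<in> E. separable_elem L K x} \<and>
      separable_ext L K {x \<in> E. separable_elem L K x}"
    using subfield_of_separables[OF E] unfolding intermediate_field_def separable_ext_def by blast
  show "F \<subseteq> {x \<in> E. separable_elem L K x}"
    if "intermediate_field L K E F \<and> separable_ext L K F" for F
    using that unfolding intermediate_field_def separable_ext_def by blast
qed

section \<open>Conjugate fields\<close>

text \<open>The image \<open>g x\<close> is a root of the monic irreducible \<open>Irr K x\<close>,
  so both elements have the same minimal polynomial, on which alone separability depends.\<close>

lemma (in algebraic_closure) Gal_separable_elem_iff:
  assumes g: "g \<in> Gal K" and x: "x \<in> carrier L"
  shows "separable_elem L K (g x) \<longleftrightarrow> separable_elem L K x"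
proof -
  have gx: "g x \<in> carrier L"
    using GalD(4)[OF g x] .
  have "eval (Irr K x) (g x) = \<zero>"
    using Gal_orbit[OF x] g unfolding is_root_def by blast
  then have "Irr K (g x) = Irr K x"
    using minimal_polynomial_is_unique[OF subfield_axioms gx algebraic_extension[OF gx]]
      Irr_props(1,3-5)[OF gx] Irr_props(1,3,4)[OF x] by blast
  then show ?thesis
    using algebraic_extension[OF x] algebraic_extension[OF gx]
    unfolding separable_elem_def over_def by simp
qed

lemma (in algebraic_closure) Gal_image_intermediate:
  assumes g: "g \<in> Gal K" and E: "subfield E L" "K \<subseteq> E"
  shows "subfield (g ` E) L" "K \<subseteq> g ` E"
proof -
  show "subfield (g ` E) L"
    using ring_hom_ring.img_is_subfield(2)[OF Gal_ring_hom_ring[OF g] E(1) one_not_zero] .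
  show "K \<subseteq> g ` E"
  proof
    fix x assume "x \<in> K"
    then show "x \<in> g ` E"
      using GalD(3)[OF g, of x] E(2) by (intro image_eqI[of _ _ x]) auto
  qed
qed

lemma (in algebraic_closure) Gal_image_max_separable_subext:
  assumes g: "g \<in> Gal K" and E: "subfield E L" "K \<subseteq> E"
  shows "max_separable_subext L K (g ` E) = g ` max_separable_subext L K E"
  using Gal_separable_elem_iff[OF g] subfieldE(3)[OF E(1)]
  unfolding max_separable_subext_eq[OF E] max_separable_subext_eq[OF Gal_image_intermediate[OF g E]]
  by blast

text \<open>An isomorphism over \<open>K\<close> is given only on \<open>E\<close>, but it extends
  to an endomorphism of \<open>L\<close>, which is an automorphism. This replaces counting
  isomorphic fields by counting an orbit.\<close>

lemma (in algebraic_closure) conjugate_fields_eq_orbit: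
  assumes E: "subfield E L" "K \<subseteq> E"
  shows "conjugate_fields L K E = (\<lambda>g. g ` E) ` Gal K"
proof (intro equalityI subsetI)
  fix F assume "F \<in> conjugate_fields L K E"
  then obtain h where F: "subfield F L" and h: "h \<in> ring_iso (L \<lparr> carrier := E \<rparr>) (L \<lparr> carrier := F \<rparr>)"
    "\<And>k. k \<in> K \<Longrightarrow> h k = k"
    unfolding conjugate_fields_def isomorphic_over_def intermediate_field_def by blast
  have "h \<in> ring_hom (L \<lparr> carrier := E \<rparr>) L"
    using ring_iso_memE[OF h(1)] subfieldE(3)[OF F] by (intro ring_hom_memI) auto
  then obtain g where g: "g \<in> ring_hom L L" "\<And>a. a \<in> E \<Longrightarrow> g a = h a"
    using hom_extend_closure[OF E] by blast
  have "g \<in> Gal K"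
    using hom_in_Gal[OF g(1)] g(2) h(2) E(2) by (metis subsetD)
  moreover have "g ` E = F"
    using ring_iso_memE(5)[OF h(1)] g(2) unfolding bij_betw_def by simp
  ultimately show "F \<in> (\<lambda>g. g ` E) ` Gal K"
    by blast
next
  fix F assume "F \<in> (\<lambda>g. g ` E) ` Gal K"
  then obtain g where g: "g \<in> Gal K" "F = g ` E"
    by blast
  note img = Gal_image_intermediate[OF g(1) E]
  have EL: "E \<subseteq> carrier L"
    using subfieldE(3)[OF E(1)] .
  have "inj_on g E"
    using Gal_inj[OF g(1)] EL by (intro inj_onI) blast
  moreover have "g (x \<otimes> y) = g x \<otimes> g y" "g (x \<oplus> y) = g x \<oplus> g y" if "x \<in> E" "y \<in> E" for x y
    using ring_hom_memE(2,3)[OF GalD(1)[OF g(1)]] that EL by blast+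
  ultimately have "g \<in> ring_iso (L \<lparr> carrier := E \<rparr>) (L \<lparr> carrier := F \<rparr>)"
    unfolding g(2) using ring_hom_memE(4)[OF GalD(1)[OF g(1)]]
    by (intro ring_iso_memI) (simp_all add: bij_betw_def)
  then show "F \<in> conjugate_fields L K E"
    using img subfieldE(3)[OF img(1)] GalD(3)[OF g(1)]
    unfolding g(2) conjugate_fields_def isomorphic_over_def intermediate_field_def by blast
qed

section \<open>Finiteness and fibre counting\<close>

text \<open>A conjugate field is the span of the image of a fixed basis, and this image is a list of
  fixed length with entries from a finite union of orbits.\<close>

lemma (in algebraic_closure) finite_conjugate_fields:
  assumes "finite_ext L K E"
  shows "finite (conjugate_fields L K E)"
proof -
  have E: "subfield E L" "K \<subseteq> E" and "finite_dimension K E"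
    using assms unfolding finite_ext_def intermediate_field_def by auto
  then obtain n where "dimension n K E"
    by blast
  then obtain Us where Us: "set Us \<subseteq> carrier L" "Span K Us = E"
    using exists_base[OF subfield_axioms] by blast
  let ?V = "\<Union>x \<in> set Us. (\<lambda>g. g x) ` Gal K"
  have "finite {xs. set xs \<subseteq> ?V \<and> length xs = length Us}"
    using Gal_orbit_card(1) Us(1) by (intro finite_lists_length_eq) blast
  moreover have "conjugate_fields L K E \<subseteq> Span K ` {xs. set xs \<subseteq> ?V \<and> length xs = length Us}"
  proof
    fix F assume "F \<in> conjugate_fields L K E"
    then obtain g where g: "g \<in> Gal K" "F = g ` E"
      unfolding conjugate_fields_eq_orbit[OF E] by blast
    have "g ` K = K"
      using GalD(3)[OF g(1)] by simp
    then have "F = Span K (map g Us)"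
      using ring_hom_ring.Span_hom[OF Gal_ring_hom_ring[OF g(1)] subfieldE(3)[OF subfield_axioms] Us(1)]
      unfolding g(2) Us(2) by simp
    moreover have "set (map g Us) \<subseteq> ?V"
      using g(1) by auto
    ultimately show "F \<in> Span K ` {xs. set xs \<subseteq> ?V \<and> length xs = length Us}"
      by (intro image_eqI[of _ _ "map g Us"]) simp_all
  qed
  ultimately show ?thesis
    by (rule finite_surj)
qed

text \<open>The orbit of \<open>E\<close> is partitioned by the fibres of the map onto the orbit of
  \<open>S\<close>, all of equal size. The product form together with positivity of the first factor
  allows division later.\<close>

lemma (in algebraic_closure) card_conjugate_fields_eq:
  assumes fin: "finite_ext L K E"
  defines "S \<equiv> max_separable_subext L K E"
  shows "card (conjugate_fields L K E) = card (conjugate_fields L K S) *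
      card {F \<in> conjugate_fields L K E. max_separable_subext L K F = S}"
    and "card (conjugate_fields L K S) > 0"
proof -
  let ?C = "conjugate_fields L K" and ?m = "max_separable_subext L K"
  have E: "subfield E L" "K \<subseteq> E"
    using fin unfolding finite_ext_def intermediate_field_def by auto
  have S: "subfield S L" "K \<subseteq> S"
    using subfield_of_separables[OF E] separable_elem_base E(2)
    unfolding S_def max_separable_subext_eq[OF E] by blast+
  note C = conjugate_fields_eq_orbit[OF E] conjugate_fields_eq_orbit[OF S]
  have m_orbit: "?m (g ` E) = g ` S" if "g \<in> Gal K" for g
    using Gal_image_max_separable_subext[OF that E] unfolding S_def .
  have img: "?m ` ?C E = ?C S"
    unfolding C image_image using m_orbit by (intro image_cong) simp_all
  have finC: "finite (?C E)"
    using finite_conjugate_fields[OF fin] .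
  have fibre: "card {F \<in> ?C E. ?m F = M} = card {F \<in> ?C E. ?m F = S}" if M: "M \<in> ?C S" for M
  proof -
    obtain g where g: "g \<in> Gal K" "M = g ` S"
      using M unfolding C by blast
    have K: "K \<subseteq> carrier L"
      using subfieldE(3)[OF subfield_axioms] .
    have sub: "F \<subseteq> carrier L" "subfield F L" "K \<subseteq> F" if "F \<in> ?C E" for F
      using that unfolding conjugate_fields_def intermediate_field_def by blast+
    have closed: "h ` F \<in> ?C E" if hF: "h \<in> Gal K" "F \<in> ?C E" for h F
    proof -
      obtain f where f: "f \<in> Gal K" "F = f ` E"
        using hF(2) unfolding C by blast
      have "h ` F = (h \<circ> f) ` E"
        unfolding f(2) by (simp add: image_comp)
      then show ?thesis
        unfolding C using Gal_comp[OF hF(1) f(1)] by blast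
    qed
    have inv: "h ` inv_into (carrier L) h ` F = F" "inv_into (carrier L) h ` h ` F = F"
      if h: "h \<in> Gal K" and F: "F \<subseteq> carrier L" for h F
    proof -
      have "h (inv_into (carrier L) h x) = x" "inv_into (carrier L) h (h x) = x" if "x \<in> F" for x
        using Gal_inv(2,3)[OF h K, of x] that F by blast+
      then show "h ` inv_into (carrier L) h ` F = F" "inv_into (carrier L) h ` h ` F = F"
        by (simp_all add: image_image)
    qed
    let ?h = "inv_into (carrier L) g"
    have h: "?h \<in> Gal K"
      using Gal_inv(1)[OF g(1) K] .
    have SL: "S \<subseteq> carrier L"
      using subfieldE(3)[OF S(1)] .
    have "bij_betw ((`) g) {F \<in> ?C E. ?m F = S} {F \<in> ?C E. ?m F = M}"
    proof (rule bij_betw_byWitness[where f' = "(`) ?h"])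
      show "\<forall>F \<in> {F \<in> ?C E. ?m F = S}. ?h ` g ` F = F" "\<forall>F \<in> {F \<in> ?C E. ?m F = M}. g ` ?h ` F = F"
        using inv[OF g(1)] sub(1) by simp_all
      show "(`) g ` {F \<in> ?C E. ?m F = S} \<subseteq> {F \<in> ?C E. ?m F = M}"
        using closed[OF g(1)] Gal_image_max_separable_subext[OF g(1) sub(2,3)] g(2) by auto
      show "(`) ?h ` {F \<in> ?C E. ?m F = M} \<subseteq> {F \<in> ?C E. ?m F = S}"
        using closed[OF h] Gal_image_max_separable_subext[OF h sub(2,3)] inv(2)[OF g(1) SL]
        unfolding g(2) by auto
    qed
    from bij_betw_same_card[OF this] show ?thesis
      by simp
  qed
  have "card (?C E) = (\<Sum>M \<in> ?m ` ?C E. card {F \<in> ?C E. ?m F = M})"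
    using sum.image_gen[OF finC, of "\<lambda>_. 1::nat" ?m] by simp
  also have "\<dots> = (\<Sum>M \<in> ?C S. card {F \<in> ?C E. ?m F = S})"
    unfolding img using fibre by (rule sum.cong[OF refl])
  finally show "card (?C E) = card (?C S) * card {F \<in> ?C E. ?m F = S}"
    by simp
  have "?C S \<noteq> {}"
    unfolding C using id_in_Gal by blast
  moreover have "finite (?C S)"
    unfolding img[symmetric] using finC by simp
  ultimately show "card (?C S) > 0"
    by (simp add: card_gt_0_iff)
qed

text \<open>Finiteness is asserted along with the count because \<open>card\<close> is 0 on infinite
  sets. The quotient is one of reals, so the equation also says that the division is exact.\<close>

theorem proposition2p19:
  fixes \<Omega> :: "('a, 'b) ring_scheme" and K L :: "'a set"
  assumes "algebraic_closure \<Omega> K"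
    and "finite_ext \<Omega> K L"
  shows "finite {L' \<in> conjugate_fields \<Omega> K L.
            max_separable_subext \<Omega> K L' = max_separable_subext \<Omega> K L} \<and>
         real (card {L' \<in> conjugate_fields \<Omega> K L.
            max_separable_subext \<Omega> K L' = max_separable_subext \<Omega> K L}) =
         real (num_conjugate_fields \<Omega> K L) /
         real (num_conjugate_fields \<Omega> K (max_separable_subext \<Omega> K L))"
proof -
  interpret algebraic_closure \<Omega> K
    by (rule assms(1))
  show ?thesis
    using finite_conjugate_fields[OF assms(2)] card_conjugate_fields_eq[OF assms(2)]
    unfolding num_conjugate_fields_def by simp
qed

end
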